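(* For any well quasi-ordered posets $P_0,P_1,\dots,P_n$ (with $n<\omega$), $\mathbf{w}\bigl(\prod_{i\le n}P_i\bigr)\ge\mathbf{w}\bigl(\prod_{i\le n}\mathbf{h}(P_i)\bigr)$.
   Context: Products carry the componentwise (product) order; each ordinal $\mathbf{h}(P_i)$ is regarded as a linear order. For a tree of non-empty finite sequences ordered by strict initial segment $\sqsubset$ with no infinite branch, its rank is the least ordinal $\gamma$ admitting $f$ into $\gamma$ with $s\sqsubset t\implies f(s)>f(t)$. $\mathbf{h}(P)$ is the rank of the tree of non-empty strictly decreasing sequences of $P$; $\mathbf{w}(P)$ is the rank of the tree of non-empty sequences of pairwise incomparable elements of $P$. A well quasi-order is a quasi-order with no infinite strictly decreasing sequences and no infinite antichains. *)

theory Defs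
  imports "HOL-Library.FuncSet" "HOL-Library.Sublist"
begin

unbundle cardinal_syntax

text \<open>
  Following \<^theory>\<open>HOL.Order_Relation\<close>, a (quasi-)ordered set is a reflexive relation \<open>r\<close> with
  carrier \<open>Field r\<close>, so \<open>(x, y) \<in> r\<close> reads \<open>x \<le> y\<close>. An ordinal is a relation satisfying \<^const>\<open>Well_order\<close>;
  ordinals, possibly over different types, are compared by \<open>\<le>o\<close>.
\<close>

definition below :: "'a rel \<Rightarrow> 'a \<Rightarrow> 'a \<Rightarrow> bool" where
  "below r x y \<longleftrightarrow> (x, y) \<in> r \<and> (y, x) \<notin> r"

definition incomparable :: "'a rel \<Rightarrow> 'a \<Rightarrow> 'a \<Rightarrow> bool" where
  "incomparable r x y \<longleftrightarrow> (x, y) \<notin> r \<and> (y, x) \<notin> r"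

definition antichain :: "'a rel \<Rightarrow> 'a set \<Rightarrow> bool" where
  "antichain r A \<longleftrightarrow> A \<subseteq> Field r \<and> (\<forall>x\<in>A. \<forall>y\<in>A. x \<noteq> y \<longrightarrow> incomparable r x y)"

definition well_quasi_order :: "'a rel \<Rightarrow> bool" where
  "well_quasi_order r \<longleftrightarrow>
     Preorder r \<and>
     (\<nexists>f::nat \<Rightarrow> 'a. \<forall>i. below r (f (Suc i)) (f i)) \<and>
     (\<nexists>A. antichain r A \<and> infinite A)"

definition prod_order :: "'i set \<Rightarrow> ('i \<Rightarrow> 'a rel) \<Rightarrow> ('i \<Rightarrow> 'a) rel" where
  "prod_order I P =
     {(x, y). x \<in> (\<Pi>\<^sub>E i\<in>I. Field (P i)) \<and> y \<in> (\<Pi>\<^sub>E i\<in>I. Field (P i)) \<and> (\<forall>i\<in>I. (x i, y i) \<in> P i)}"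

definition admits_rank_fun :: "'a list set \<Rightarrow> 'b rel \<Rightarrow> bool" where
  "admits_rank_fun T \<gamma> \<longleftrightarrow>
     (\<exists>f. f ` T \<subseteq> Field \<gamma> \<and> (\<forall>s\<in>T. \<forall>t\<in>T. strict_prefix s t \<longrightarrow> below \<gamma> (f t) (f s)))"

text \<open>
  The rank is a well-order on the type of the nodes themselves, determined up to isomorphism. The
  lemmas \<open>tree_rank_exists\<close> and \<open>tree_rank_le\<close> show that this choice of type is harmless: the rank
  exists when there is no infinite branch, and is least among the suitable well-orders over all types.
\<close>

definition tree_rank :: "'a list set \<Rightarrow> 'a list rel" where
  "tree_rank T = (SOME \<gamma>. Well_order \<gamma> \<and> admits_rank_fun T \<gamma> \<and>
     (\<forall>\<delta>::'a list rel. Well_order \<delta> \<and> admits_rank_fun T \<delta> \<longrightarrow> \<gamma> \<le>o \<delta>))"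

definition dec_tree :: "'a rel \<Rightarrow> 'a list set" where
  "dec_tree r = {xs. xs \<noteq> [] \<and> set xs \<subseteq> Field r \<and> sorted_wrt (\<lambda>x y. below r y x) xs}"

definition inc_tree :: "'a rel \<Rightarrow> 'a list set" where
  "inc_tree r = {xs. xs \<noteq> [] \<and> set xs \<subseteq> Field r \<and> sorted_wrt (incomparable r) xs}"

definition ord_height :: "'a rel \<Rightarrow> 'a list rel" where
  "ord_height r = tree_rank (dec_tree r)"

definition ord_width :: "'a rel \<Rightarrow> 'a list rel" where
  "ord_width r = tree_rank (inc_tree r)"


lemma admits_rank_fun_ordIso:
  assumes "\<gamma> =o \<delta>" "admits_rank_fun T \<gamma>"
  shows "admits_rank_fun T \<delta>"
proof -
  obtain h where h: "bij_betw h (Field \<gamma>) (Field \<delta>)"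
    "\<And>a b. a \<in> Field \<gamma> \<Longrightarrow> b \<in> Field \<gamma> \<Longrightarrow> (a, b) \<in> \<gamma> \<longleftrightarrow> (h a, h b) \<in> \<delta>"
    using assms(1) unfolding ordIso_def iso_iff2 by blast
  obtain f where f: "f ` T \<subseteq> Field \<gamma>"
    "\<And>s t. s \<in> T \<Longrightarrow> t \<in> T \<Longrightarrow> strict_prefix s t \<Longrightarrow> below \<gamma> (f t) (f s)"
    using assms(2) unfolding admits_rank_fun_def by blast
  have "(h \<circ> f) ` T \<subseteq> Field \<delta>" using f(1) h(1) unfolding bij_betw_def by auto
  moreover have "below \<delta> ((h \<circ> f) t) ((h \<circ> f) s)" if "s \<in> T" "t \<in> T" "strict_prefix s t" for s t
  proof -
    have "f s \<in> Field \<gamma>" "f t \<in> Field \<gamma>" using that f(1) by blast+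
    then show ?thesis using f(2)[OF that] h(2) unfolding below_def by simp
  qed
  ultimately show ?thesis unfolding admits_rank_fun_def by blast
qed

lemma admits_rank_fun_node_type:
  fixes T :: "'a list set" and \<gamma> :: "'b rel"
  assumes "Well_order \<gamma>" "admits_rank_fun T \<gamma>"
  shows "\<exists>\<delta>::'a list rel. Well_order \<delta> \<and> admits_rank_fun T \<delta>"
proof -
  obtain f where f: "f ` T \<subseteq> Field \<gamma>"
    and mono: "\<And>s t. s \<in> T \<Longrightarrow> t \<in> T \<Longrightarrow> strict_prefix s t \<Longrightarrow> below \<gamma> (f t) (f s)"
    using assms(2) unfolding admits_rank_fun_def by blast
  define \<rho> where "\<rho> = Restr \<gamma> (f ` T)"
  define g where "g = inv_into T f"
  have wo: "Well_order \<rho>" unfolding \<rho>_def by (rule Well_order_Restr[OF assms(1)])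
  have F: "Field \<rho> = f ` T"
    unfolding \<rho>_def using assms(1) f
    by (intro Refl_Field_Restr2) (auto simp: order_on_defs)
  have "admits_rank_fun T \<rho>"
    unfolding admits_rank_fun_def
  proof (intro exI[of _ f] conjI ballI impI)
    show "f ` T \<subseteq> Field \<rho>" using F by blast
    show "below \<rho> (f t) (f s)" if "s \<in> T" "t \<in> T" "strict_prefix s t" for s t
      using mono[OF that] that unfolding below_def \<rho>_def by blast
  qed
  moreover have inj: "inj_on g (Field \<rho>)"
    unfolding g_def F by (rule inj_on_inv_into) simp
  ultimately have "admits_rank_fun T (dir_image \<rho> g)"
    using dir_image_ordIso[OF wo inj] admits_rank_fun_ordIso by blast
  then show ?thesis using Well_order_dir_image[OF wo inj] by blast
qed

lemma tree_rank_le: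
  fixes T :: "'a list set" and \<gamma> :: "'b rel"
  assumes "Well_order \<gamma>" "admits_rank_fun T \<gamma>"
  shows "Well_order (tree_rank T)" "admits_rank_fun T (tree_rank T)" "tree_rank T \<le>o \<gamma>"
proof -
  let ?W = "{\<delta>::'a list rel. Well_order \<delta> \<and> admits_rank_fun T \<delta>}"
  have "\<exists>\<rho>\<in>?W. \<forall>\<rho>'\<in>?W. \<rho> \<le>o \<rho>'"
    using admits_rank_fun_node_type[OF assms] by (intro exists_minim_Well_order) auto
  then have "\<exists>\<rho>::'a list rel. Well_order \<rho> \<and> admits_rank_fun T \<rho> \<and>
     (\<forall>\<delta>::'a list rel. Well_order \<delta> \<and> admits_rank_fun T \<delta> \<longrightarrow> \<rho> \<le>o \<delta>)" by blast
  note * = someI_ex[OF this, folded tree_rank_def]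
  show wo: "Well_order (tree_rank T)" and "admits_rank_fun T (tree_rank T)" using * by blast+
  show "tree_rank T \<le>o \<gamma>"
  proof (rule ccontr)
    assume "\<not> tree_rank T \<le>o \<gamma>"
    then have "\<gamma> <o tree_rank T" using not_ordLeq_iff_ordLess[OF assms(1) wo] by blast
    then obtain p :: "'a list rel" where p: "\<gamma> =o p" "p <o tree_rank T"
      unfolding internalize_ordLess[of \<gamma>] by blast
    have "admits_rank_fun T p" using admits_rank_fun_ordIso[OF p(1) assms(2)] .
    moreover have "Well_order p" using p(1) unfolding ordIso_def by blast
    ultimately show False using * p(2) not_ordLess_ordLeq by blast
  qed
qed

lemma tree_rank_exists:
  fixes T :: "'a list set"
  assumes "\<nexists>b::nat \<Rightarrow> 'a list. \<forall>i. b i \<in> T \<and> strict_prefix (b i) (b (Suc i))"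
  shows "Well_order (tree_rank T)" "admits_rank_fun T (tree_rank T)"
proof -
  define R where "R = cardSuc |UNIV :: 'a list set|"
  have inf: "infinite (UNIV :: 'a list set)" by (rule infinite_UNIV_listI)
  have co: "Card_order R" unfolding R_def by (intro cardSuc_Card_order card_of_Card_order)
  have less: "|UNIV :: 'a list set| <o R" unfolding R_def by (intro cardSuc_greater card_of_Card_order)
  have infR: "infinite (Field R)" unfolding R_def using inf by (simp add: card_of_cardSuc_finite)
  have reg: "regularCard R" unfolding R_def using inf by (intro infinite_cardSuc_regularCard card_of_Card_order) (simp add: Field_card_of)
  have wo: "Well_order R" using co unfolding card_order_on_def by blast
  have refl: "refl_on (Field R) R" and trans: "trans R" and antisym: "antisym R"
    and total: "total_on (Field R) R"
    using wo unfolding order_on_defs by blast+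
  have bounded: "\<exists>y\<in>Field R. \<forall>k\<in>K. (k, y) \<in> R \<and> k \<noteq> y"
    if K: "K \<subseteq> Field R" "|K| \<le>o |UNIV :: 'a list set|" for K
  proof (rule ccontr)
    assume n: "\<not> ?thesis"
    have "cofinal K R" unfolding cofinal_def
    proof
      fix a assume a: "a \<in> Field R"
      obtain a' where a': "a' \<in> Field R" "a \<noteq> a'" "(a, a') \<in> R"
        using infinite_Card_order_limit[OF co infR a] by blast
      obtain k where k: "k \<in> K" "\<not> ((k, a') \<in> R \<and> k \<noteq> a')" using n a' by blast
      then have "(a', k) \<in> R"
        using a'(1) K(1) refl_onD[OF refl] total unfolding total_on_def by (metis subsetD)
      then have "(a, k) \<in> R" "a \<noteq> k"
        using a'(2,3) transD[OF trans] antisymD[OF antisym] by blast+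
      then show "\<exists>b\<in>K. a \<noteq> b \<and> (a, b) \<in> R" using k by blast
    qed
    then have "|K| =o R" using reg K unfolding regularCard_def by blast
    moreover have "|K| <o R" using K less ordLeq_ordLess_trans by blast
    ultimately show False using not_ordLess_ordIso by blast
  qed
  define S where "S = {(t, s). s \<in> T \<and> t \<in> T \<and> strict_prefix s t}"
  have wf: "wf S" using assms unfolding wf_iff_no_infinite_down_chain S_def by fastforce
  define G where "G = (\<lambda>f t. SOME y. y \<in> Field R \<and> (\<forall>s. (s, t) \<in> S \<longrightarrow> (f s, y) \<in> R \<and> f s \<noteq> y))"
  define f where "f = wfrec S G"
  have unf: "f t = G f t" for t
    unfolding f_def by (subst wfrec[OF wf]) (simp add: G_def cut_def)
  have f: "f t \<in> Field R \<and> (\<forall>s. (s, t) \<in> S \<longrightarrow> (f s, f t) \<in> R \<and> f s \<noteq> f t)" for t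
    using wf
  proof (induction t rule: wf_induct_rule)
    case (less t)
    have "|f ` {s. (s, t) \<in> S}| \<le>o |UNIV :: 'a list set|"
      using card_of_image card_of_mono1[OF subset_UNIV] ordLeq_transitive by blast
    then have "\<exists>y\<in>Field R. \<forall>k\<in>f ` {s. (s, t) \<in> S}. (k, y) \<in> R \<and> k \<noteq> y"
      using less by (intro bounded) auto
    then have "\<exists>y. y \<in> Field R \<and> (\<forall>s. (s, t) \<in> S \<longrightarrow> (f s, y) \<in> R \<and> f s \<noteq> y)" by blast
    from someI_ex[OF this] show ?case by (subst (1 3 5) unf) (simp add: G_def)
  qed
  have "admits_rank_fun T R"
    unfolding admits_rank_fun_def
  proof (intro exI[of _ f] conjI ballI impI)
    show "f ` T \<subseteq> Field R" using f by blast
    fix s t assume "s \<in> T" "t \<in> T" "strict_prefix s t"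
    then have "(f t, f s) \<in> R" "f t \<noteq> f s" using f unfolding S_def by blast+
    then show "below R (f t) (f s)"
      using antisymD[OF antisym] unfolding below_def by blast
  qed
  then show "Well_order (tree_rank T)" "admits_rank_fun T (tree_rank T)"
    using tree_rank_le[OF wo] by blast+
qed

end

(*
  Wolk's theorem: a well partial order P contains a chain isomorphic to h(P). The level of rank
  \<alpha> is a non-empty antichain, hence finite, and below an element of rank \<beta> there are elements of
  every smaller rank, so finitely many levels always have a common transversal that is a chain;
  compactness gives one for all levels. Hence the product of the h(P_i) embeds into the product
  of the P_i, and the width is monotone under embeddings.
*)
theory Submission
  imports Defs "HOL-Library.Ramsey"
begin

section \<open>Compactness for choices from finite sets\<close>

(* A minimal family of candidates that still has compatible choices on all finite sets has exactly
   one candidate for every index: if there were two, then neither could be deleted, and the two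
   finite sets witnessing this would together have no choice. *)
lemma compatible_choice_compactness:
  fixes I :: "'i set" and L :: "'i \<Rightarrow> 'a set" and R :: "'i \<Rightarrow> 'a \<Rightarrow> 'i \<Rightarrow> 'a \<Rightarrow> bool"
  assumes fin: "\<And>i. i \<in> I \<Longrightarrow> finite (L i)"
    and choice: "\<And>F. finite F \<Longrightarrow> F \<subseteq> I \<Longrightarrow>
      \<exists>c. \<forall>i\<in>F. c i \<in> L i \<and> (\<forall>j\<in>F. R i (c i) j (c j))"
  shows "\<exists>c. \<forall>i\<in>I. c i \<in> L i \<and> (\<forall>j\<in>I. R i (c i) j (c j))"
proof -
  \<comment> \<open>\<open>D\<close> collects the deleted candidates, so a minimal remaining family
    is a maximal good \<open>D\<close>, which is what Zorn's lemma provides.\<close>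
  define ok where "ok D F \<longleftrightarrow>
    (\<exists>c. \<forall>i\<in>F. (i, c i) \<in> Sigma I L - D \<and> (\<forall>j\<in>F. R i (c i) j (c j)))" for D F
  define good where "good D \<longleftrightarrow> (\<forall>F. finite F \<and> F \<subseteq> I \<longrightarrow> ok D F)" for D
  have "\<exists>M\<in>Collect good. \<forall>X\<in>Collect good. M \<subseteq> X \<longrightarrow> X = M"
  proof (rule subset_Zorn_nonempty)
    have "good {}"
      unfolding good_def
    proof (intro allI impI)
      fix F assume F: "finite F \<and> F \<subseteq> I"
      then obtain c where "\<forall>i\<in>F. c i \<in> L i \<and> (\<forall>j\<in>F. R i (c i) j (c j))"
        using choice by blast
      then show "ok {} F"
        unfolding ok_def using F by (intro exI[of _ c]) auto
    qed
    then show "Collect good \<noteq> {}" by blast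
  next
    fix C assume C: "C \<noteq> {}" "subset.chain (Collect good) C"
    have "good (\<Union>C)"
      unfolding good_def
    proof (intro allI impI)
      fix F assume F: "finite F \<and> F \<subseteq> I"
      \<comment> \<open>Only the deletions at indices in \<open>F\<close> matter for
        \<open>F\<close>; they are finitely many, so one member \<open>D\<close> of the chain
        contains them all.\<close>
      have "finite (\<Union>C \<inter> Sigma F L)"
        using F fin by (intro finite_Int disjI2 finite_SigmaI) auto
      then obtain D where D: "D \<in> C" "\<Union>C \<inter> Sigma F L \<subseteq> D"
        using finite_subset_Union_chain[of "\<Union>C \<inter> Sigma F L" C] C by blast
      then have "good D" using C(2) unfolding subset.chain_def by blast
      then obtain c where c: "\<forall>i\<in>F. (i, c i) \<in> Sigma I L - D \<and> (\<forall>j\<in>F. R i (c i) j (c j))"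
        using F unfolding good_def ok_def by blast
      then show "ok (\<Union>C) F"
        unfolding ok_def using D(2) by (intro exI[of _ c] ballI conjI) auto
    qed
    then show "\<Union>C \<in> Collect good" by blast
  qed
  then obtain M where M: "good M" "\<And>X. good X \<Longrightarrow> M \<subseteq> X \<Longrightarrow> X = M" by blast
  have unique: "x = y"
    if x: "(i, x) \<in> Sigma I L - M" and y: "(i, y) \<in> Sigma I L - M" for i x y
  proof (rule ccontr)
    assume "x \<noteq> y"
    have "\<not> good (insert (i, z) M)" if "(i, z) \<in> Sigma I L - M" for z
      using M(2)[of "insert (i, z) M"] that by blast
    then have "\<not> good (insert (i, x) M)" "\<not> good (insert (i, y) M)" using x y by blast+
    then obtain Fx Fy where
      Fx: "finite Fx" "Fx \<subseteq> I" "\<not> ok (insert (i, x) M) Fx" and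
      Fy: "finite Fy" "Fy \<subseteq> I" "\<not> ok (insert (i, y) M) Fy"
      unfolding good_def by blast
    have "finite (insert i (Fx \<union> Fy)) \<and> insert i (Fx \<union> Fy) \<subseteq> I"
      using x Fx(1,2) Fy(1,2) by blast
    then have "ok M (insert i (Fx \<union> Fy))" using M(1) unfolding good_def by blast
    then obtain c where c: "\<forall>k\<in>insert i (Fx \<union> Fy). (k, c k) \<in> Sigma I L - M \<and>
        (\<forall>j\<in>insert i (Fx \<union> Fy). R k (c k) j (c j))"
      unfolding ok_def by (elim exE)
    \<comment> \<open>A choice with value \<open>x\<close> at \<open>i\<close> survives deleting
      \<open>(i, y)\<close>, and any other survives deleting \<open>(i, x)\<close>; so
      \<open>Fy\<close> or \<open>Fx\<close> has a choice after all.\<close>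
    show False
    proof (cases "c i = x")
      case True
      then have "\<forall>k\<in>Fy. (k, c k) \<in> Sigma I L - insert (i, y) M \<and> (\<forall>j\<in>Fy. R k (c k) j (c j))"
        using c \<open>x \<noteq> y\<close> by auto
      then show False using Fy(3) unfolding ok_def by blast
    next
      case False
      then have "\<forall>k\<in>Fx. (k, c k) \<in> Sigma I L - insert (i, x) M \<and> (\<forall>j\<in>Fx. R k (c k) j (c j))"
        using c by auto
      then show False using Fx(3) unfolding ok_def by blast
    qed
  qed
  define c where "c i = (THE x. (i, x) \<in> Sigma I L - M)" for i
  have c: "c i = x" if "(i, x) \<in> Sigma I L - M" for i x
    unfolding c_def using that unique by (intro the_equality) blast+
  \<comment> \<open>Since \<open>R\<close> is binary, index sets of at most two elements suffice;
    uniqueness makes the choices on them agree with \<open>c\<close>.\<close>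
  have pair: "(i, c i) \<in> Sigma I L - M \<and> R i (c i) j (c j)" if ij: "i \<in> I" "j \<in> I" for i j
  proof -
    have "finite {i, j} \<and> {i, j} \<subseteq> I" using ij by simp
    then have "ok M {i, j}" using M(1) unfolding good_def by blast
    then obtain d where d: "\<forall>k\<in>{i, j}. (k, d k) \<in> Sigma I L - M \<and> (\<forall>l\<in>{i, j}. R k (d k) l (d l))"
      unfolding ok_def by (elim exE)
    then have "c i = d i" "c j = d j" using c by blast+
    then show ?thesis using d by simp
  qed
  then show ?thesis by (intro exI[of _ c]) blast
qed

section \<open>Finite sets and comparison in linear orders\<close>

lemma finite_Linear_order_has_greatest:
  assumes "Linear_order r" "finite F" "F \<noteq> {}" "F \<subseteq> Field r"
  shows "\<exists>m\<in>F. \<forall>a\<in>F. (a, m) \<in> r"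
  using assms(2-)
proof (induction F rule: finite_ne_induct)
  case (singleton x)
  then show ?case using assms(1) by (auto simp: order_on_defs refl_on_def)
next
  case (insert x F)
  then obtain m where m: "m \<in> F" "\<forall>a\<in>F. (a, m) \<in> r" by auto
  have r: "refl_on (Field r) r" "trans r" "total_on (Field r) r"
    using assms(1) by (auto simp: order_on_defs)
  have x: "x \<in> Field r" and mF: "m \<in> Field r" using insert.prems m by auto
  show ?case
  proof (cases "(x, m) \<in> r")
    case True
    then show ?thesis using m by auto
  next
    case False
    then have "(m, x) \<in> r"
      using r(1,3) x mF unfolding total_on_def by (metis refl_onD)
    then show ?thesis using m r(1,2) x by (auto intro: transD refl_onD)
  qed
qed

lemma Linear_order_not_below:
  assumes "Linear_order r" "a \<in> Field r" "b \<in> Field r" "\<not> below r a b"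
  shows "(b, a) \<in> r"
  using assms unfolding below_def order_on_defs total_on_def by (metis refl_onD)

section \<open>Infinite branches, Ramsey's theorem and finite products\<close>

text \<open>Along a branch the lists prolong each other and their lengths grow beyond all bounds, so
  they glue to one infinite sequence that inherits the pairwise relation. This serves the tree of
  decreasing as well as the tree of incomparable sequences.\<close>

lemma branch_gives_sequence:
  assumes "\<And>i. b i \<in> T" "\<And>i. strict_prefix (b i) (b (Suc i))"
    and "\<And>xs. xs \<in> T \<Longrightarrow> set xs \<subseteq> A \<and> sorted_wrt R xs"
  shows "\<exists>x::nat \<Rightarrow> 'a. range x \<subseteq> A \<and> (\<forall>i j. i < j \<longrightarrow> R (x i) (x j))"
proof -
  have len: "i \<le> length (b i)" for i
  proof (induction i)
    case (Suc i)
    then show ?case using prefix_length_less[OF assms(2)[of i]] by simp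
  qed simp
  have pre: "prefix (b i) (b j)" if "i \<le> j" for i j
    using that
  proof (induction j rule: dec_induct)
    case (step j)
    then show ?case using assms(2)[of j] by (meson prefix_order.trans strict_prefix_def)
  qed simp
  \<comment> \<open>\<open>b i\<close> may have only \<open>i\<close> entries, whereas
    \<open>b (Suc i)\<close> is sure to have one at position \<open>i\<close>.\<close>
  define x where "x i = b (Suc i) ! i" for i
  have nth: "x i = b j ! i" "i < length (b j)" if "i < j" for i j
  proof -
    have l: "i < length (b (Suc i))" using len[of "Suc i"] by simp
    show "x i = b j ! i"
      using pre[of "Suc i" j] that l unfolding x_def by (auto simp: prefix_def nth_append)
    show "i < length (b j)" using that len[of j] by simp
  qed
  have "x i \<in> A" for i
    using nth[of i "Suc i"] assms(1,3) by (metis lessI nth_mem subsetD)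
  moreover have "R (x i) (x j)" if "i < j" for i j
  proof -
    have "sorted_wrt R (b (Suc j))" using assms(1,3) by blast
    then show ?thesis
      using that nth[of i "Suc j"] nth[of j "Suc j"] by (simp add: sorted_wrt_iff_nth_less)
  qed
  ultimately show ?thesis by blast
qed

text \<open>With this, \<open>tree_rank_exists\<close> applies, so that \<open>ord_height\<close> of
  a well quasi-order is a genuine least rank.\<close>

lemma dec_tree_no_infinite_branch:
  assumes "well_quasi_order P"
  shows "\<nexists>b::nat \<Rightarrow> 'a list. \<forall>i. b i \<in> dec_tree P \<and> strict_prefix (b i) (b (Suc i))"
proof
  assume "\<exists>b::nat \<Rightarrow> 'a list. \<forall>i. b i \<in> dec_tree P \<and> strict_prefix (b i) (b (Suc i))"
  then obtain b :: "nat \<Rightarrow> 'a list"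
    where b: "\<And>i. b i \<in> dec_tree P" "\<And>i. strict_prefix (b i) (b (Suc i))" by blast
  have "\<exists>x::nat \<Rightarrow> 'a. range x \<subseteq> Field P \<and> (\<forall>i j. i < j \<longrightarrow> below P (x j) (x i))"
    by (rule branch_gives_sequence[where b = b, OF b]) (simp add: dec_tree_def)
  then obtain x :: "nat \<Rightarrow> 'a" where "\<And>i j. i < j \<Longrightarrow> below P (x j) (x i)" by blast
  then have "\<forall>i. below P (x (Suc i)) (x i)" by blast
  then show False using assms unfolding well_quasi_order_def by blast
qed

text \<open>Ramsey's theorem with three colours for pairs: ascending, strictly descending,
  incomparable. The last two colours would yield an infinite strictly decreasing sequence or an
  infinite antichain.\<close>

lemma well_quasi_order_mono_subseq:
  fixes x :: "nat \<Rightarrow> 'a"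
  assumes "well_quasi_order P" "range x \<subseteq> Field P"
  shows "\<exists>\<phi>::nat \<Rightarrow> nat. strict_mono \<phi> \<and> (\<forall>i j. i < j \<longrightarrow> (x (\<phi> i), x (\<phi> j)) \<in> P)"
proof -
  have refl: "refl_on (Field P) P"
    using assms(1) unfolding well_quasi_order_def order_on_defs by blast
  \<comment> \<open>The colouring sees an unordered pair of indices; \<open>Min\<close> and
    \<open>Max\<close> recover which term comes first.\<close>
  define col where "col X = (if (x (Min X), x (Max X)) \<in> P then 0
    else if (x (Max X), x (Min X)) \<in> P then 1 else 2 :: nat)" for X
  have "\<forall>i\<in>UNIV. \<forall>j\<in>UNIV. i \<noteq> j \<longrightarrow> col {i, j} < 3" by (simp add: col_def)
  from Ramsey2[OF infinite_UNIV_nat this]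
  obtain Y t where Y: "infinite Y" and t: "t < 3" "\<And>i j. i \<in> Y \<Longrightarrow> j \<in> Y \<Longrightarrow> i \<noteq> j \<Longrightarrow> col {i, j} = t"
    by blast
  define \<phi> where "\<phi> = enumerate Y"
  have mono: "strict_mono \<phi>" unfolding \<phi>_def by (rule strict_mono_enumerate[OF Y])
  have col: "t = (if (x (\<phi> i), x (\<phi> j)) \<in> P then 0
    else if (x (\<phi> j), x (\<phi> i)) \<in> P then 1 else 2)" if "i < j" for i j
  proof -
    have lt: "\<phi> i < \<phi> j" using that mono by (simp add: strict_mono_def)
    then have "t = col {\<phi> i, \<phi> j}"
      using t(2)[of "\<phi> i" "\<phi> j"] enumerate_in_set[OF Y] unfolding \<phi>_def by simp
    moreover have "Min {\<phi> i, \<phi> j} = \<phi> i" "Max {\<phi> i, \<phi> j} = \<phi> j" using lt by simp_all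
    ultimately show ?thesis unfolding col_def by simp
  qed
  consider "t = 0" | "t = 1" | "t = 2" using t(1) by linarith
  then have "t = 0"
  proof cases
    case 2
    have "below P (x (\<phi> (Suc i))) (x (\<phi> i))" for i
      using col[OF lessI, of i] 2 unfolding below_def by (simp split: if_splits)
    then have "\<exists>f::nat \<Rightarrow> 'a. \<forall>i. below P (f (Suc i)) (f i)"
      by (intro exI[of _ "\<lambda>i. x (\<phi> i)"]) blast
    then show ?thesis using assms(1) unfolding well_quasi_order_def by blast
  next
    case 3
    have inc: "incomparable P (x (\<phi> i)) (x (\<phi> j))" if "i < j" for i j
      using col[OF that] 3 unfolding incomparable_def by (simp split: if_splits)
    have inc': "incomparable P (x (\<phi> i)) (x (\<phi> j))" if "i \<noteq> j" for i j
      using that inc[of i j] inc[of j i] unfolding incomparable_def by (cases "i < j") auto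
    \<comment> \<open>Reflexivity keeps incomparable terms distinct, so that the antichain is
      infinite.\<close>
    have "inj (\<lambda>i. x (\<phi> i))"
      using inc' refl assms(2) unfolding incomparable_def inj_on_def
      by (metis rangeI refl_onD subsetD)
    then have "infinite (range (\<lambda>i. x (\<phi> i)))" using finite_imageD by blast
    moreover have "antichain P (range (\<lambda>i. x (\<phi> i)))"
      unfolding antichain_def using assms(2) inc' by (auto, metis)
    ultimately show ?thesis using assms(1) unfolding well_quasi_order_def by blast
  qed
  then have "(x (\<phi> i), x (\<phi> j)) \<in> P" if "i < j" for i j
    using col[OF that] by (simp split: if_splits)
  then show ?thesis using mono by blast
qed

text \<open>The sequence is thinned out once for each factor; a further subsequence keeps the
  coordinates already treated ascending.\<close>

lemma prod_order_mono_subseq: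
  fixes x :: "nat \<Rightarrow> 'i \<Rightarrow> 'a"
  assumes "finite I" "\<And>i. i \<in> I \<Longrightarrow> well_quasi_order (P i)"
    and "\<And>k i. i \<in> I \<Longrightarrow> x k i \<in> Field (P i)"
  shows "\<exists>\<phi>::nat \<Rightarrow> nat. strict_mono \<phi> \<and> (\<forall>k l. k < l \<longrightarrow> (\<forall>i\<in>I. (x (\<phi> k) i, x (\<phi> l) i) \<in> P i))"
  using assms
proof (induction I rule: finite_induct)
  case empty
  then show ?case by (auto intro: exI[of _ id] simp: strict_mono_def)
next
  case (insert i I)
  then obtain \<phi> :: "nat \<Rightarrow> nat" where \<phi>: "strict_mono \<phi>"
    "\<And>k l j. k < l \<Longrightarrow> j \<in> I \<Longrightarrow> (x (\<phi> k) j, x (\<phi> l) j) \<in> P j" by auto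
  have "\<exists>\<psi>::nat \<Rightarrow> nat. strict_mono \<psi> \<and> (\<forall>k l. k < l \<longrightarrow> (x (\<phi> (\<psi> k)) i, x (\<phi> (\<psi> l)) i) \<in> P i)"
    by (rule well_quasi_order_mono_subseq) (use insert.prems in auto)
  then obtain \<psi> :: "nat \<Rightarrow> nat" where \<psi>: "strict_mono \<psi>"
    "\<And>k l. k < l \<Longrightarrow> (x (\<phi> (\<psi> k)) i, x (\<phi> (\<psi> l)) i) \<in> P i" by blast
  show ?case
    using \<phi> \<psi> by (intro exI[of _ "\<phi> \<circ> \<psi>"]) (auto simp: strict_mono_def)
qed

text \<open>\<open>Field\<close> only sees points that occur in some pair; reflexive factors relate
  every tuple to itself.\<close>

lemma Field_prod_order:
  assumes "\<And>i. i \<in> I \<Longrightarrow> Refl (P i)"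
  shows "Field (prod_order I P) = (\<Pi>\<^sub>E i\<in>I. Field (P i))"
proof
  show "Field (prod_order I P) \<subseteq> (\<Pi>\<^sub>E i\<in>I. Field (P i))"
    unfolding prod_order_def Field_def by blast
  show "(\<Pi>\<^sub>E i\<in>I. Field (P i)) \<subseteq> Field (prod_order I P)"
  proof
    fix x assume x: "x \<in> (\<Pi>\<^sub>E i\<in>I. Field (P i))"
    then have "(x, x) \<in> prod_order I P"
      using assms unfolding prod_order_def by (auto intro!: refl_onD dest: PiE_mem)
    then show "x \<in> Field (prod_order I P)" by (rule FieldI1)
  qed
qed

text \<open>An infinite branch would be a sequence of pairwise incomparable tuples, whereas some
  subsequence ascends in all coordinates at once. By \<open>tree_rank_exists\<close> the width of
  the product is then a genuine ordinal.\<close>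

lemma inc_tree_prod_order_no_infinite_branch:
  fixes P :: "'i \<Rightarrow> 'a rel"
  assumes "finite I" "\<And>i. i \<in> I \<Longrightarrow> well_quasi_order (P i)"
  shows "\<nexists>b::nat \<Rightarrow> ('i \<Rightarrow> 'a) list.
    \<forall>k. b k \<in> inc_tree (prod_order I P) \<and> strict_prefix (b k) (b (Suc k))"
proof
  assume "\<exists>b::nat \<Rightarrow> ('i \<Rightarrow> 'a) list.
    \<forall>k. b k \<in> inc_tree (prod_order I P) \<and> strict_prefix (b k) (b (Suc k))"
  then obtain b :: "nat \<Rightarrow> ('i \<Rightarrow> 'a) list"
    where b: "\<And>k. b k \<in> inc_tree (prod_order I P)" "\<And>k. strict_prefix (b k) (b (Suc k))" by blast
  have "Refl (P i)" if "i \<in> I" for i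
    using assms(2)[OF that] unfolding well_quasi_order_def order_on_defs by blast
  then have field: "Field (prod_order I P) = (\<Pi>\<^sub>E i\<in>I. Field (P i))" by (rule Field_prod_order)
  have "\<exists>x::nat \<Rightarrow> 'i \<Rightarrow> 'a. range x \<subseteq> Field (prod_order I P) \<and>
    (\<forall>k l. k < l \<longrightarrow> incomparable (prod_order I P) (x k) (x l))"
    by (rule branch_gives_sequence[where b = b, OF b]) (simp add: inc_tree_def)
  then obtain x :: "nat \<Rightarrow> 'i \<Rightarrow> 'a" where "range x \<subseteq> Field (prod_order I P)"
    and inc: "\<forall>k l. k < l \<longrightarrow> incomparable (prod_order I P) (x k) (x l)" by blast
  then have x: "x k \<in> (\<Pi>\<^sub>E i\<in>I. Field (P i))" for k unfolding field by (meson rangeI subsetD)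
  have "\<exists>\<phi>::nat \<Rightarrow> nat. strict_mono \<phi> \<and> (\<forall>k l. k < l \<longrightarrow> (\<forall>i\<in>I. (x (\<phi> k) i, x (\<phi> l) i) \<in> P i))"
    using assms x by (intro prod_order_mono_subseq) (auto dest: PiE_mem)
  then obtain \<phi> :: "nat \<Rightarrow> nat" where \<phi>: "strict_mono \<phi>"
    "\<And>k l i. k < l \<Longrightarrow> i \<in> I \<Longrightarrow> (x (\<phi> k) i, x (\<phi> l) i) \<in> P i" by blast
  have "(x (\<phi> 0), x (\<phi> 1)) \<in> prod_order I P"
    using x \<phi>(2)[OF zero_less_one] unfolding prod_order_def by blast
  moreover have "\<phi> 0 < \<phi> 1" using \<phi>(1) by (simp add: strict_mono_def)
  ultimately show False using inc unfolding incomparable_def by blast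
qed

section \<open>Monotonicity of the width\<close>

text \<open>Applying \<open>e\<close> entrywise preserves incomparability and strict prefixes, so a
  rank function for \<open>R\<close> pulls back to one for \<open>Q\<close>, and the least rank for
  \<open>Q\<close> is no larger.\<close>

lemma ord_width_mono_embedding:
  fixes Q :: "'a rel" and R :: "'b rel"
  assumes wo: "Well_order (ord_width R)" and rank: "admits_rank_fun (inc_tree R) (ord_width R)"
    and e: "\<And>a. a \<in> Field Q \<Longrightarrow> e a \<in> Field R"
      "\<And>a b. a \<in> Field Q \<Longrightarrow> b \<in> Field Q \<Longrightarrow> (a, b) \<in> Q \<longleftrightarrow> (e a, e b) \<in> R"
  shows "ord_width Q \<le>o ord_width R"
proof -
  obtain f where f: "f ` inc_tree R \<subseteq> Field (ord_width R)"
    "\<And>s t. s \<in> inc_tree R \<Longrightarrow> t \<in> inc_tree R \<Longrightarrow> strict_prefix s t \<Longrightarrow> below (ord_width R) (f t) (f s)"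
    using rank unfolding admits_rank_fun_def by blast
  have map: "map e s \<in> inc_tree R" if s: "s \<in> inc_tree Q" for s
  proof -
    have "sorted_wrt (\<lambda>a b. incomparable R (e a) (e b)) s"
      using s e(2) unfolding inc_tree_def incomparable_def
      by (auto elim!: sorted_wrt_mono_rel[rotated])
    then show ?thesis using s e(1) unfolding inc_tree_def by (auto simp: sorted_wrt_map)
  qed
  have pre: "strict_prefix (map e s) (map e t)" if "strict_prefix s t" for s t
    using that by (auto simp: strict_prefix_def prefix_def)
  have "admits_rank_fun (inc_tree Q) (ord_width R)"
    unfolding admits_rank_fun_def
    using f map pre by (intro exI[of _ "f \<circ> map e"]) auto
  then show ?thesis using tree_rank_le(3)[OF wo] unfolding ord_width_def by blast
qed

section \<open>Ranks of points and the height\<close>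

text \<open>Ranks points where \<open>admits_rank_fun\<close> ranks decreasing sequences; for a
  preorder, \<open>admits_rank_fun_dec_tree_iff\<close> shows that the same ordinals admit both
  kinds of ranks.\<close>

definition rank_map :: "'a rel \<Rightarrow> 'b rel \<Rightarrow> ('a \<Rightarrow> 'b) \<Rightarrow> bool" where
  "rank_map P \<gamma> g \<longleftrightarrow> g ` Field P \<subseteq> Field \<gamma> \<and> (\<forall>x y. below P y x \<longrightarrow> below \<gamma> (g y) (g x))"

lemma below_Field:
  assumes "below r x y"
  shows "x \<in> Field r" "y \<in> Field r"
  using assms unfolding below_def by (auto intro: FieldI1 FieldI2)

lemma Linear_order_below_le_trans:
  assumes "Linear_order r" "below r a b" "(b, c) \<in> r"
  shows "below r a c"
  using assms unfolding below_def order_on_defs by (meson transD)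

lemma Linear_order_le_below_trans:
  assumes "Linear_order r" "(a, b) \<in> r" "below r b c"
  shows "below r a c"
  using assms unfolding below_def order_on_defs by (meson transD)

lemma Linear_order_below_cases:
  assumes "Linear_order r" "a \<in> Field r" "b \<in> Field r" "a \<noteq> b" "\<not> below r a b"
  shows "below r b a"
  using assms Linear_order_not_below[OF assms(1-3,5)]
  unfolding below_def order_on_defs by (meson antisymD)

lemma Well_order_least:
  assumes "Well_order r" "A \<subseteq> Field r" "A \<noteq> {}"
  shows "\<exists>m\<in>A. \<forall>a\<in>A. (m, a) \<in> r"
  using assms Linear_order_Well_order_iff[of r] unfolding well_order_on_def by blast

text \<open>A decreasing sequence can take the rank of its last entry. Conversely, a point takes the
  least rank of a sequence ending in it; prolonging such a sequence by a smaller point lowers the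
  rank.\<close>

lemma admits_rank_fun_dec_tree_iff:
  fixes P :: "'a rel" and \<gamma> :: "'b rel"
  assumes refl: "Refl P" and tr: "trans P" and wo: "Well_order \<gamma>"
  shows "admits_rank_fun (dec_tree P) \<gamma> \<longleftrightarrow> (\<exists>g. rank_map P \<gamma> g)"
proof
  assume "admits_rank_fun (dec_tree P) \<gamma>"
  then obtain f where f: "f ` dec_tree P \<subseteq> Field \<gamma>"
    "\<And>s t. s \<in> dec_tree P \<Longrightarrow> t \<in> dec_tree P \<Longrightarrow> strict_prefix s t \<Longrightarrow> below \<gamma> (f t) (f s)"
    unfolding admits_rank_fun_def by blast
  have lin: "Linear_order \<gamma>" using wo unfolding well_order_on_def by blast
  define V where "V x = f ` {s @ [x] | s. s @ [x] \<in> dec_tree P}" for x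
  have "\<exists>m\<in>V x. \<forall>a\<in>V x. (m, a) \<in> \<gamma>" if "x \<in> Field P" for x
  proof (rule Well_order_least[OF wo])
    show "V x \<subseteq> Field \<gamma>" using f(1) unfolding V_def by blast
    have "[] @ [x] \<in> dec_tree P" using that by (simp add: dec_tree_def)
    then show "V x \<noteq> {}" unfolding V_def by blast
  qed
  then obtain g where g: "\<And>x. x \<in> Field P \<Longrightarrow> g x \<in> V x"
    "\<And>x a. x \<in> Field P \<Longrightarrow> a \<in> V x \<Longrightarrow> (g x, a) \<in> \<gamma>" by metis
  have "g ` Field P \<subseteq> Field \<gamma>" using g(1) f(1) unfolding V_def by blast
  moreover have "below \<gamma> (g y) (g x)" if yx: "below P y x" for x y
  proof -
    have F: "x \<in> Field P" "y \<in> Field P" using below_Field[OF yx] by auto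
    obtain s where s: "g x = f (s @ [x])" "s @ [x] \<in> dec_tree P"
      using g(1)[OF F(1)] unfolding V_def by blast
    \<comment> \<open>Transitivity puts \<open>y\<close> below all of \<open>s\<close>, so that the
      prolonged sequence is still decreasing.\<close>
    have "below P y z" if "z \<in> set s" for z
    proof -
      have "below P x z" using s(2) that by (auto simp: dec_tree_def sorted_wrt_append)
      then show ?thesis using yx tr unfolding below_def by (meson transD)
    qed
    then have t: "(s @ [x]) @ [y] \<in> dec_tree P"
      using s(2) F yx by (auto simp: dec_tree_def sorted_wrt_append)
    then have "below \<gamma> (f ((s @ [x]) @ [y])) (g x)"
      unfolding s(1) by (intro f(2)[OF s(2)]) (auto simp: strict_prefix_def)
    moreover have "(g y, f ((s @ [x]) @ [y])) \<in> \<gamma>"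
    proof (rule g(2)[OF F(2)])
      show "f ((s @ [x]) @ [y]) \<in> V y" using t unfolding V_def by blast
    qed
    ultimately show ?thesis using Linear_order_le_below_trans[OF lin] by blast
  qed
  ultimately show "\<exists>g. rank_map P \<gamma> g" unfolding rank_map_def by blast
next
  assume "\<exists>g. rank_map P \<gamma> g"
  then obtain g where g: "g ` Field P \<subseteq> Field \<gamma>" "\<And>x y. below P y x \<Longrightarrow> below \<gamma> (g y) (g x)"
    unfolding rank_map_def by blast
  show "admits_rank_fun (dec_tree P) \<gamma>"
    unfolding admits_rank_fun_def
  proof (intro exI[of _ "g \<circ> last"] conjI ballI impI)
    show "(g \<circ> last) ` dec_tree P \<subseteq> Field \<gamma>" using g(1) last_in_set by (fastforce simp: dec_tree_def)
    fix s t assume st: "s \<in> dec_tree P" "t \<in> dec_tree P" "strict_prefix s t"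
    then obtain u where u: "t = s @ u" "u \<noteq> []" by (auto simp: strict_prefix_def prefix_def)
    have "below P (last u) (last s)"
      using st u by (auto simp: dec_tree_def sorted_wrt_append)
    then show "below \<gamma> ((g \<circ> last) t) ((g \<circ> last) s)" using g(2) u by simp
  qed
qed

(* The pointwise least rank map skips no value, since a skipped value could be used to lower it. *)
lemma ord_height_levels:
  assumes wqo: "well_quasi_order P"
  shows "Well_order (ord_height P)"
    and "\<exists>\<rho>. rank_map P (ord_height P) \<rho> \<and> \<rho> ` Field P = Field (ord_height P) \<and>
      (\<forall>x\<in>Field P. \<forall>\<alpha>. below (ord_height P) \<alpha> (\<rho> x) \<longrightarrow> (\<exists>y. below P y x \<and> \<rho> y = \<alpha>))"
proof -
  let ?\<gamma> = "ord_height P"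
  have refl: "Refl P" and tr: "trans P"
    using wqo unfolding well_quasi_order_def order_on_defs by blast+
  note no_branch = dec_tree_no_infinite_branch[OF wqo]
  show wo: "Well_order ?\<gamma>"
    unfolding ord_height_def by (rule tree_rank_exists(1)[OF no_branch])
  have lin: "Linear_order ?\<gamma>" using wo unfolding well_order_on_def by blast
  have "admits_rank_fun (dec_tree P) ?\<gamma>"
    unfolding ord_height_def by (rule tree_rank_exists(2)[OF no_branch])
  then obtain g0 where g0: "rank_map P ?\<gamma> g0"
    using admits_rank_fun_dec_tree_iff[OF refl tr wo] by blast
  have "\<exists>m\<in>{g x | g. rank_map P ?\<gamma> g}. \<forall>a\<in>{g x | g. rank_map P ?\<gamma> g}. (m, a) \<in> ?\<gamma>"
    if "x \<in> Field P" for x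
  proof (rule Well_order_least[OF wo])
    show "{g x | g. rank_map P ?\<gamma> g} \<subseteq> Field ?\<gamma>" using that unfolding rank_map_def by blast
    show "{g x | g. rank_map P ?\<gamma> g} \<noteq> {}" using g0 by blast
  qed
  then obtain \<rho> where \<rho>: "\<And>x. x \<in> Field P \<Longrightarrow> \<exists>g. rank_map P ?\<gamma> g \<and> \<rho> x = g x"
    "\<And>x g. x \<in> Field P \<Longrightarrow> rank_map P ?\<gamma> g \<Longrightarrow> (\<rho> x, g x) \<in> ?\<gamma>"
    by (atomize_elim, simp) metis
  \<comment> \<open>For \<open>y\<close> below \<open>x\<close>, a rank map \<open>g\<close>
    attaining the minimum at \<open>x\<close> gives
    \<open>\<rho> y \<le> g y < g x = \<rho> x\<close>.\<close>
  have rm: "rank_map P ?\<gamma> \<rho>"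
    unfolding rank_map_def
  proof (intro conjI allI impI)
    show "\<rho> ` Field P \<subseteq> Field ?\<gamma>" using \<rho>(1) unfolding rank_map_def by fastforce
    fix x y assume yx: "below P y x"
    then obtain g where g: "rank_map P ?\<gamma> g" "\<rho> x = g x" using \<rho>(1) below_Field by metis
    have "(\<rho> y, g y) \<in> ?\<gamma>" using \<rho>(2) g(1) below_Field[OF yx] by blast
    moreover have "below ?\<gamma> (g y) (g x)" using g(1) yx unfolding rank_map_def by blast
    ultimately show "below ?\<gamma> (\<rho> y) (\<rho> x)"
      unfolding g(2) using Linear_order_le_below_trans[OF lin] by blast
  qed
  have \<rho>F: "\<rho> x \<in> Field ?\<gamma>" if "x \<in> Field P" for x
    using rm that unfolding rank_map_def by blast
  have "wf {(y, x). below P y x}"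
    using wqo unfolding wf_iff_no_infinite_down_chain well_quasi_order_def by simp
  then have skip: "\<exists>y. below P y x \<and> \<rho> y = \<alpha>" if "x \<in> Field P" "below ?\<gamma> \<alpha> (\<rho> x)" for x \<alpha>
    using that
  proof (induction x rule: wf_induct_rule)
    case (less x)
    show ?case
    proof (rule ccontr)
      assume none: "\<nexists>y. below P y x \<and> \<rho> y = \<alpha>"
      \<comment> \<open>A point below \<open>x\<close> of rank above \<alpha> has, by induction, a
        point of rank \<alpha> below it, which is then below \<open>x\<close> too.\<close>
      have lower: "below ?\<gamma> (\<rho> y) \<alpha>" if y: "below P y x" for y
      proof (rule ccontr)
        assume n: "\<not> below ?\<gamma> (\<rho> y) \<alpha>"
        have "\<rho> y \<noteq> \<alpha>" using none y by blast
        then have "below ?\<gamma> \<alpha> (\<rho> y)"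
          using Linear_order_below_cases[OF lin] n \<rho>F below_Field(1)[OF y]
            below_Field(1)[OF less.prems(2)] by blast
        then obtain z where "below P z y" "\<rho> z = \<alpha>"
          using less.IH[of y] y below_Field(1)[OF y] by blast
        moreover have "below P z x"
          using \<open>below P z y\<close> y tr unfolding below_def by (meson transD)
        ultimately show False using none by blast
      qed
      \<comment> \<open>Points below \<open>x\<close> have rank below \<alpha>, and points above
        \<open>x\<close> only gain room, so the value at \<open>x\<close> can be lowered to
        \<alpha>. This contradicts the minimality of \<open>\<rho> x\<close>.\<close>
      have "rank_map P ?\<gamma> (\<rho>(x := \<alpha>))"
        unfolding rank_map_def
      proof (intro conjI allI impI)
        show "(\<rho>(x := \<alpha>)) ` Field P \<subseteq> Field ?\<gamma>"
          using \<rho>F below_Field(1)[OF less.prems(2)] by auto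
        fix u v assume vu: "below P v u"
        have "below ?\<gamma> (\<rho> v) (\<rho> u)" using rm vu unfolding rank_map_def by blast
        moreover have "u \<noteq> v" using vu unfolding below_def by blast
        moreover have "below ?\<gamma> \<alpha> (\<rho> u)" if "v = x"
          using that less.prems(2) calculation(1) Linear_order_below_le_trans[OF lin]
          unfolding below_def[of _ "\<rho> v"] by blast
        ultimately show "below ?\<gamma> ((\<rho>(x := \<alpha>)) v) ((\<rho>(x := \<alpha>)) u)"
          using lower vu by auto
      qed
      from \<rho>(2)[OF less.prems(1) this] show False using less.prems(2) by (simp add: below_def)
    qed
  qed
  \<comment> \<open>A missed value \<beta> bounds all ranks strictly, since a point of larger rank
    would have one of rank \<beta> below it. Then \<rho> maps into the proper initial segment below
    \<beta>, which is shorter than the height.\<close>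
  have "\<rho> ` Field P = Field ?\<gamma>"
  proof (rule ccontr)
    assume "\<rho> ` Field P \<noteq> Field ?\<gamma>"
    then obtain \<beta> where \<beta>: "\<beta> \<in> Field ?\<gamma>" "\<beta> \<notin> \<rho> ` Field P" using \<rho>F by blast
    have lt: "below ?\<gamma> (\<rho> x) \<beta>" if x: "x \<in> Field P" for x
    proof (rule ccontr)
      assume "\<not> below ?\<gamma> (\<rho> x) \<beta>"
      moreover have "\<rho> x \<noteq> \<beta>" using \<beta>(2) x by blast
      ultimately have "below ?\<gamma> \<beta> (\<rho> x)"
        using Linear_order_below_cases[OF lin] \<rho>F[OF x] \<beta>(1) by blast
      then show False using skip[OF x] \<beta>(2) below_Field(1) by (metis image_eqI)
    qed
    define \<delta> where "\<delta> = Restr ?\<gamma> (underS ?\<gamma> \<beta>)"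
    have und: "\<rho> x \<in> underS ?\<gamma> \<beta>" if "x \<in> Field P" for x
      using lt[OF that] \<rho>F[OF that] unfolding below_def underS_def by auto
    have less: "\<delta> <o ?\<gamma>" unfolding \<delta>_def by (rule underS_Restr_ordLess[OF wo]) (use \<beta>(1) in auto)
    have wo\<delta>: "Well_order \<delta>" unfolding \<delta>_def by (rule Well_order_Restr[OF wo])
    have "Field \<delta> = underS ?\<gamma> \<beta>"
      unfolding \<delta>_def using wo
      by (intro Refl_Field_Restr2) (auto simp: order_on_defs underS_def intro: FieldI1)
    moreover have "below \<delta> (\<rho> y) (\<rho> x)" if "below P y x" for x y
      using rm that und below_Field[OF that] unfolding rank_map_def \<delta>_def below_def by blast
    ultimately have "rank_map P \<delta> \<rho>" using und unfolding rank_map_def by blast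
    then have "?\<gamma> \<le>o \<delta>"
      using admits_rank_fun_dec_tree_iff[OF refl tr wo\<delta>] tree_rank_le(3)[OF wo\<delta>]
      unfolding ord_height_def by blast
    then show False using less not_ordLess_ordLeq by blast
  qed
  then show "\<exists>\<rho>. rank_map P ?\<gamma> \<rho> \<and> \<rho> ` Field P = Field ?\<gamma> \<and>
      (\<forall>x\<in>Field P. \<forall>\<alpha>. below ?\<gamma> \<alpha> (\<rho> x) \<longrightarrow> (\<exists>y. below P y x \<and> \<rho> y = \<alpha>))"
    using rm skip by blast
qed

section \<open>Wolk's theorem on chains of full height\<close>

text \<open>The order is reflected as well as preserved because incomparable tuples of ordinals must
  go to incomparable tuples of points.\<close>

theorem Wolk_chain:
  assumes po: "Partial_order P" and wqo: "well_quasi_order P"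
  shows "\<exists>e. \<forall>a\<in>Field (ord_height P). e a \<in> Field P \<and>
    (\<forall>b\<in>Field (ord_height P). (a, b) \<in> ord_height P \<longleftrightarrow> (e a, e b) \<in> P)"
proof -
  let ?\<gamma> = "ord_height P"
  have refl: "refl_on (Field P) P" and tr: "trans P" and anti: "antisym P"
    using po unfolding order_on_defs by blast+
  have wo: "Well_order ?\<gamma>" by (rule ord_height_levels(1)[OF wqo])
  have lin: "Linear_order ?\<gamma>" using wo unfolding well_order_on_def by blast
  from ord_height_levels(2)[OF wqo] obtain \<rho> where \<rho>: "rank_map P ?\<gamma> \<rho>" "\<rho> ` Field P = Field ?\<gamma>"
    "\<forall>x\<in>Field P. \<forall>\<alpha>. below ?\<gamma> \<alpha> (\<rho> x) \<longrightarrow> (\<exists>y. below P y x \<and> \<rho> y = \<alpha>)"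
    by (elim exE conjE)
  have descend: "\<exists>y. (y, x) \<in> P \<and> \<rho> y = \<alpha>" if "x \<in> Field P" "(\<alpha>, \<rho> x) \<in> ?\<gamma>" for x \<alpha>
  proof (cases "\<alpha> = \<rho> x")
    case True
    then show ?thesis using refl that by (auto intro: refl_onD)
  next
    case False
    then have "below ?\<gamma> \<alpha> (\<rho> x)"
      using that(2) lin unfolding below_def order_on_defs by (meson antisymD)
    then show ?thesis using \<rho>(3) that(1) unfolding below_def by blast
  qed
  define L where "L \<alpha> = {x \<in> Field P. \<rho> x = \<alpha>}" for \<alpha>
  have fin: "finite (L \<alpha>)" for \<alpha>
  proof -
    \<comment> \<open>Points of equal rank are never strictly comparable, and antisymmetry excludes
      distinct equivalent ones; so each level is an antichain and hence finite.\<close>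
    have "incomparable P x y" if "x \<in> L \<alpha>" "y \<in> L \<alpha>" "x \<noteq> y" for x y
    proof -
      have "\<rho> x = \<rho> y" using that by (simp add: L_def)
      moreover have "\<rho> u \<noteq> \<rho> v" if "below P u v" for u v
        using that \<rho>(1) unfolding rank_map_def below_def[of ?\<gamma>] by fastforce
      ultimately have "\<not> below P x y" "\<not> below P y x" by metis+
      then show ?thesis
        using that anti unfolding incomparable_def below_def by (meson antisymD)
    qed
    then have "antichain P (L \<alpha>)" unfolding antichain_def L_def by auto
    then show ?thesis using wqo unfolding well_quasi_order_def by blast
  qed
  \<comment> \<open>The transversal is chosen from the top down: the point picked for the greatest
    index becomes the bound for the others, so \<open>x\<close> has to vary in the
    induction.\<close>
  have below_x: "\<exists>c. \<forall>\<alpha>\<in>F. c \<alpha> \<in> L \<alpha> \<and> (c \<alpha>, x) \<in> P \<and> (\<forall>\<beta>\<in>F. (\<alpha>, \<beta>) \<in> ?\<gamma> \<longrightarrow> (c \<alpha>, c \<beta>) \<in> P)"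
    if "finite F" "F \<subseteq> Field ?\<gamma>" "x \<in> Field P" "\<forall>\<alpha>\<in>F. (\<alpha>, \<rho> x) \<in> ?\<gamma>" for F x
    using that
  proof (induction F arbitrary: x rule: finite_psubset_induct)
    case (psubset F)
    show ?case
    proof (cases "F = {}")
      case False
      then obtain m where m: "m \<in> F" "\<forall>a\<in>F. (a, m) \<in> ?\<gamma>"
        using finite_Linear_order_has_greatest[OF lin psubset.hyps] psubset.prems(1) by blast
      obtain y where y: "(y, x) \<in> P" "\<rho> y = m" using descend m(1) psubset.prems by blast
      have yF: "y \<in> Field P" using y(1) by (rule FieldI1)
      have "F - {m} \<subset> F" using m(1) by blast
      then obtain c where c: "\<forall>\<alpha>\<in>F - {m}. c \<alpha> \<in> L \<alpha> \<and> (c \<alpha>, y) \<in> P \<and>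
          (\<forall>\<beta>\<in>F - {m}. (\<alpha>, \<beta>) \<in> ?\<gamma> \<longrightarrow> (c \<alpha>, c \<beta>) \<in> P)"
        using psubset.IH[of "F - {m}" y] yF psubset.prems(1) m(2) y(2) by blast
      \<comment> \<open>No other index lies above \<open>m\<close>, so only relations into
        \<open>y\<close> have to hold, and the bound in the induction hypothesis supplies
        them.\<close>
      have m_max: "\<alpha> = m" if "\<alpha> \<in> F" "(m, \<alpha>) \<in> ?\<gamma>" for \<alpha>
        using that m(2) lin unfolding order_on_defs by (meson antisymD)
      have yy: "(y, y) \<in> P" using refl yF by (rule refl_onD)
      have "(c(m := y)) \<alpha> \<in> L \<alpha>" if "\<alpha> \<in> F" for \<alpha>
        using that c y(2) yF by (auto simp: L_def)
      moreover have "((c(m := y)) \<alpha>, x) \<in> P" if "\<alpha> \<in> F" for \<alpha>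
        using that c y(1) tr by (auto dest: transD)
      moreover have "((c(m := y)) \<alpha>, (c(m := y)) \<beta>) \<in> P" if "\<alpha> \<in> F" "\<beta> \<in> F" "(\<alpha>, \<beta>) \<in> ?\<gamma>" for \<alpha> \<beta>
        using that c yy m_max by auto
      ultimately show ?thesis by blast
    qed auto
  qed
  \<comment> \<open>The levels are the finite candidate sets for compactness, and the relation binds
    two choices only when their indices are in order.\<close>
  have "\<exists>c. \<forall>\<alpha>\<in>Field ?\<gamma>. c \<alpha> \<in> L \<alpha> \<and> (\<forall>\<beta>\<in>Field ?\<gamma>. (\<alpha>, \<beta>) \<in> ?\<gamma> \<longrightarrow> (c \<alpha>, c \<beta>) \<in> P)"
  proof (rule compatible_choice_compactness[OF fin])
    fix F assume F: "finite F" "F \<subseteq> Field ?\<gamma>"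
    show "\<exists>c. \<forall>\<alpha>\<in>F. c \<alpha> \<in> L \<alpha> \<and> (\<forall>\<beta>\<in>F. (\<alpha>, \<beta>) \<in> ?\<gamma> \<longrightarrow> (c \<alpha>, c \<beta>) \<in> P)"
    proof (cases "F = {}")
      case False
      then obtain m where m: "m \<in> F" "\<forall>a\<in>F. (a, m) \<in> ?\<gamma>"
        using finite_Linear_order_has_greatest[OF lin F(1)] F(2) by blast
      \<comment> \<open>The bound for the finite transversal is a point of the greatest rank in
        \<open>F\<close>, which exists because every rank is attained.\<close>
      then have "m \<in> \<rho> ` Field P" using \<rho>(2) F(2) by auto
      then obtain x where "x \<in> Field P" "\<rho> x = m" by blast
      then show ?thesis using below_x[OF F] m(2) by blast
    qed auto
  qed
  then obtain c where c: "\<And>\<alpha>. \<alpha> \<in> Field ?\<gamma> \<Longrightarrow> c \<alpha> \<in> L \<alpha>"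
    "\<And>\<alpha> \<beta>. \<alpha> \<in> Field ?\<gamma> \<Longrightarrow> \<beta> \<in> Field ?\<gamma> \<Longrightarrow> (\<alpha>, \<beta>) \<in> ?\<gamma> \<Longrightarrow> (c \<alpha>, c \<beta>) \<in> P" by blast
  \<comment> \<open>If \<beta> \<le> \<alpha>, monotonicity and antisymmetry make the two choices
    equal, so their ranks \<alpha> and \<beta> agree; otherwise linearity gives the claim.\<close>
  have "(\<alpha>, \<beta>) \<in> ?\<gamma>" if "\<alpha> \<in> Field ?\<gamma>" "\<beta> \<in> Field ?\<gamma>" "(c \<alpha>, c \<beta>) \<in> P" for \<alpha> \<beta>
  proof (cases "(\<beta>, \<alpha>) \<in> ?\<gamma>")
    case True
    then have "c \<alpha> = c \<beta>" using c(2) that anti by (meson antisymD)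
    then have "\<alpha> = \<beta>" using c(1)[OF that(1)] c(1)[OF that(2)] unfolding L_def by simp
    then show ?thesis using True by simp
  next
    case False
    then show ?thesis
      using Linear_order_not_below[OF lin that(2,1)] unfolding below_def by blast
  qed
  then show ?thesis using c unfolding L_def by (intro exI[of _ c]) blast
qed

section \<open>Coordinatewise embedding of the product of the heights\<close>

theorem theorem4p13:
  fixes n :: nat and P :: "nat \<Rightarrow> 'a rel"
  assumes "\<And>i. i \<le> n \<Longrightarrow> Partial_order (P i)"
    and "\<And>i. i \<le> n \<Longrightarrow> well_quasi_order (P i)"
  shows "ord_width (prod_order {..n} (\<lambda>i. ord_height (P i))) \<le>o ord_width (prod_order {..n} P)"
proof -
  let ?H = "\<lambda>i. ord_height (P i)"
  have wo: "Well_order (?H i)" if "i \<le> n" for i using ord_height_levels(1)[OF assms(2)[OF that]] .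
  have "\<forall>i\<in>{..n}. \<exists>e. \<forall>a\<in>Field (?H i). e a \<in> Field (P i) \<and>
      (\<forall>b\<in>Field (?H i). (a, b) \<in> ?H i \<longleftrightarrow> (e a, e b) \<in> P i)"
    using Wolk_chain assms by blast
  from bchoice[OF this] obtain e where
    e: "\<And>i a. i \<le> n \<Longrightarrow> a \<in> Field (?H i) \<Longrightarrow> e i a \<in> Field (P i)"
    "\<And>i a b. i \<le> n \<Longrightarrow> a \<in> Field (?H i) \<Longrightarrow> b \<in> Field (?H i) \<Longrightarrow> (a, b) \<in> ?H i \<longleftrightarrow> (e i a, e i b) \<in> P i"
    by auto
  have FH: "Field (prod_order {..n} ?H) = (\<Pi>\<^sub>E i\<in>{..n}. Field (?H i))"
    using wo by (intro Field_prod_order) (auto simp: order_on_defs)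
  have FP: "Field (prod_order {..n} P) = (\<Pi>\<^sub>E i\<in>{..n}. Field (P i))"
    using assms(1) by (intro Field_prod_order) (auto simp: order_on_defs)
  have "finite {..n}" and wqo: "\<And>i. i \<in> {..n} \<Longrightarrow> well_quasi_order (P i)" using assms(2) by auto
  \<comment> \<open>The index set is finite and all factors are well quasi-orders, so the width of
    the target product exists as an ordinal.\<close>
  note no_branch = inc_tree_prod_order_no_infinite_branch[OF this]
  show ?thesis
  proof (rule ord_width_mono_embedding)
    show "Well_order (ord_width (prod_order {..n} P))"
      "admits_rank_fun (inc_tree (prod_order {..n} P)) (ord_width (prod_order {..n} P))"
      unfolding ord_width_def using tree_rank_exists[OF no_branch] by auto
    fix a assume a: "a \<in> Field (prod_order {..n} ?H)"
    \<comment> \<open>The restriction to \<open>{..n}\<close> keeps the image tuple extensional, as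
      membership in the product demands.\<close>
    show "(\<lambda>i\<in>{..n}. e i (a i)) \<in> Field (prod_order {..n} P)"
      using a e(1) unfolding FH FP by (auto dest: PiE_mem)
    fix b assume b: "b \<in> Field (prod_order {..n} ?H)"
    have "a i \<in> Field (?H i)" "b i \<in> Field (?H i)" if "i \<le> n" for i
      using a b that unfolding FH by (auto dest: PiE_mem)
    then have "(\<forall>i\<in>{..n}. (a i, b i) \<in> ?H i) \<longleftrightarrow>
      (\<forall>i\<in>{..n}. ((\<lambda>i\<in>{..n}. e i (a i)) i, (\<lambda>i\<in>{..n}. e i (b i)) i) \<in> P i)"
      using e(2) by simp
    moreover have "(\<lambda>i\<in>{..n}. e i (c i)) \<in> (\<Pi>\<^sub>E i\<in>{..n}. Field (P i))"
      if "c \<in> (\<Pi>\<^sub>E i\<in>{..n}. Field (?H i))" for c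
      using that e(1) by (auto dest: PiE_mem)
    ultimately show "(a, b) \<in> prod_order {..n} ?H \<longleftrightarrow>
      ((\<lambda>i\<in>{..n}. e i (a i)), (\<lambda>i\<in>{..n}. e i (b i))) \<in> prod_order {..n} P"
      using a b unfolding FH unfolding prod_order_def by blast
  qed
qed

end
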